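(* Let $P$ be a finite Boolean poset with at least two atoms. Then the zero-divisor graph $\Gamma(P)$ is very well-covered.
   Context: For a poset $P$ and $A\subseteq P$, the upper cone is $A^{u}=\{b\in P : b\ge a \text{ for all } a\in A\}$ and the lower cone is $A^{\ell}=\{b\in P : b\le a\text{ for all }a\in A\}$; $A^{u\ell}=(A^{u})^{\ell}$. A poset is bounded if it has a least element $0$ and a greatest element $1$. An atom of $P$ is an element $a>0$ such that there is no $b\in P$ with $0<b<a$. In a bounded poset, $a'$ is a complement of $a$ if $\{a,a'\}^{\ell}=\{0\}$ and $\{a,a'\}^{u}=\{1\}$; a bounded poset is complemented if every element has a complement. A poset is distributive if for all $a,b,c\in P$, $(\{a\}\cup\{b,c\}^{u})^{\ell}=(\{a,b\}^{\ell}\cup\{a,c\}^{\ell})^{u\ell}$. A Boolean poset is a bounded poset that is both distributive and complemented. For a poset $P$ with $0$, the set of zero-divisors is $Z(P)=\{a\in P : \text{there exists } b\in P\setminus\{0\}\text{ with }\{a,b\}^{\ell}=\{0\}\}$. The zero-divisor graph $\Gamma(P)$ is the simple graph with vertex set $Z(P)\setminus\{0\}$ in which two distinct vertices $a,b$ are adjacent if and only if $\{a,b\}^{\ell}=\{0\}$. A finite simple graph is well-covered if all its maximal (with respect to inclusion) independent sets have the same cardinality. It is very well-covered if it is well-covered, has no isolated vertices, and its number of vertices is exactly twice the size of a maximal independent set. *)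

theory Defs
  imports "HOL-Algebra.Order" "Graph_Theory.Pair_Digraph"
begin

text \<open>
  Posets are the carrier-based partial orders of HOL-Algebra, in which \<open>.=\<close> is equality.
  The cones of a set \<open>A\<close> of elements of \<open>L\<close> are \<^term>\<open>Upper L A\<close> and \<^term>\<open>Lower L A\<close>,
  and \<open>0\<close>, \<open>1\<close> are written \<open>\<bottom>\<close>, \<open>\<top>\<close>.
\<close>

definition is_atom :: "('a, 'b) gorder_scheme \<Rightarrow> 'a \<Rightarrow> bool" where
  "is_atom L a \<longleftrightarrow> a \<in> carrier L \<and> \<bottom>\<^bsub>L\<^esub> \<sqsubset>\<^bsub>L\<^esub> a \<and>
     \<not> (\<exists>b\<in>carrier L. \<bottom>\<^bsub>L\<^esub> \<sqsubset>\<^bsub>L\<^esub> b \<and> b \<sqsubset>\<^bsub>L\<^esub> a)"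

definition is_complement :: "('a, 'b) gorder_scheme \<Rightarrow> 'a \<Rightarrow> 'a \<Rightarrow> bool" where
  "is_complement L a a' \<longleftrightarrow> a' \<in> carrier L \<and>
     Lower L {a, a'} = {\<bottom>\<^bsub>L\<^esub>} \<and> Upper L {a, a'} = {\<top>\<^bsub>L\<^esub>}"

locale bounded_poset = partial_order L + weak_partial_order_bottom L + weak_partial_order_top L
  for L (structure)

locale complemented_poset = bounded_poset +
  assumes complemented: "a \<in> carrier L \<Longrightarrow> \<exists>a'. is_complement L a a'"

locale distributive_poset = partial_order +
  assumes distributive:
    "\<lbrakk>a \<in> carrier L; b \<in> carrier L; c \<in> carrier L\<rbrakk> \<Longrightarrow>
      Lower L ({a} \<union> Upper L {b, c}) = Lower L (Upper L (Lower L {a, b} \<union> Lower L {a, c}))"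

locale boolean_poset = complemented_poset + distributive_poset

definition zero_divisors :: "('a, 'b) gorder_scheme \<Rightarrow> 'a set" where
  "zero_divisors L =
     {a \<in> carrier L. \<exists>b \<in> carrier L - {\<bottom>\<^bsub>L\<^esub>}. Lower L {a, b} = {\<bottom>\<^bsub>L\<^esub>}}"

text \<open>
  An undirected edge is a pair of opposite arcs, and \<^const>\<open>pair_graph\<close> says that a graph is
  finite and simple.
\<close>

definition zero_divisor_graph :: "('a, 'b) gorder_scheme \<Rightarrow> 'a pair_pre_digraph" where
  "zero_divisor_graph L =
     (let V = zero_divisors L - {\<bottom>\<^bsub>L\<^esub>}
      in \<lparr>pverts = V,
          parcs = {(a, b). a \<in> V \<and> b \<in> V \<and> a \<noteq> b \<and> Lower L {a, b} = {\<bottom>\<^bsub>L\<^esub>}}\<rparr>)"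

definition independent_set :: "'a pair_pre_digraph \<Rightarrow> 'a set \<Rightarrow> bool" where
  "independent_set G I \<longleftrightarrow> I \<subseteq> pverts G \<and> (\<forall>u\<in>I. \<forall>v\<in>I. (u, v) \<notin> parcs G)"

definition maximal_independent_set :: "'a pair_pre_digraph \<Rightarrow> 'a set \<Rightarrow> bool" where
  "maximal_independent_set G I \<longleftrightarrow>
     independent_set G I \<and> (\<forall>J. independent_set G J \<and> I \<subseteq> J \<longrightarrow> J = I)"

definition isolated_vertex :: "'a pair_pre_digraph \<Rightarrow> 'a \<Rightarrow> bool" where
  "isolated_vertex G v \<longleftrightarrow> v \<in> pverts G \<and> \<not> (\<exists>w. (v, w) \<in> parcs G)"

definition well_covered :: "'a pair_pre_digraph \<Rightarrow> bool" where
  "well_covered G \<longleftrightarrow> pair_graph G \<and>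
     (\<forall>I J. maximal_independent_set G I \<and> maximal_independent_set G J \<longrightarrow> card I = card J)"

definition very_well_covered :: "'a pair_pre_digraph \<Rightarrow> bool" where
  "very_well_covered G \<longleftrightarrow> well_covered G \<and> (\<forall>v. \<not> isolated_vertex G v) \<and>
     (\<forall>I. maximal_independent_set G I \<longrightarrow> card (pverts G) = 2 * card I)"

end

theory Submission
  imports Defs
begin

text \<open>
  The proof rests on Favaron's sufficient condition for a graph to be very well-covered: a perfect
  matching \<open>v \<mapsto> m v\<close> such that every neighbour of \<open>a\<close> is adjacent to every neighbour of
  \<open>m a\<close>. A maximal independent set \<open>I\<close> then contains exactly one end of each matching edge. If it
  missed both \<open>a\<close> and \<open>m a\<close>, maximality would place a neighbour of each of them in \<open>I\<close>, and these
  two neighbours would be adjacent.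

  In the zero-divisor graph of a Boolean poset the matching is complementation. Distributivity
  turns disjointness into an inequality: if \<open>x\<close> and \<open>a\<close> have only \<open>0\<close> below them and \<open>a'\<close> is a
  complement of \<open>a\<close>, then \<open>x \<le> a'\<close>. Hence complements are unique, complementation is an
  involution, and if \<open>x\<close> is disjoint from \<open>a\<close> and \<open>y\<close> from \<open>a'\<close>, then \<open>x \<le> a'\<close> and
  \<open>y\<close> is disjoint from \<open>a'\<close>, so \<open>x\<close> and \<open>y\<close> are disjoint.
\<close>

text \<open>Otherwise \<open>a\<close> could be added to \<open>I\<close>, because it is not adjacent to itself either.\<close>

lemma maximal_independent_set_dominating:
  assumes "pair_graph G" and "maximal_independent_set G I" and "a \<in> pverts G" and "a \<notin> I"
  obtains x where "x \<in> I" and "(x, a) \<in> parcs G"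
proof (rule ccontr)
  interpret pair_graph G by fact
  assume "\<not> thesis"
  with that have no_nbr: "(x, a) \<notin> parcs G" if "x \<in> I" for x
    using \<open>x \<in> I\<close> by blast
  moreover have "(a, a) \<notin> parcs G"
    using pair_no_loops[of "(a, a)"] by auto
  moreover have "(a, x) \<notin> parcs G" if "x \<in> I" for x
    using no_nbr[OF that] arcs_symmetric by (rule contrapos_nn)
  ultimately have "independent_set G (insert a I)"
    using assms by (auto simp: maximal_independent_set_def independent_set_def)
  then show False
    using assms by (auto simp: maximal_independent_set_def)
qed

text \<open>Every maximal independent set \<open>I\<close> meets each matching edge in exactly one end, so \<open>m\<close> maps
  \<open>I\<close> bijectively onto its complement in the vertex set. The number of vertices is then twice the
  size of \<open>I\<close>, which also makes all maximal independent sets equally large.\<close>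

lemma very_well_covered_if_matching:
  assumes graph: "pair_graph G"
    and arc: "\<And>v. v \<in> pverts G \<Longrightarrow> (v, m v) \<in> parcs G"
    and invol: "\<And>v. v \<in> pverts G \<Longrightarrow> m (m v) = v"
    and cross: "\<And>x a y. (x, a) \<in> parcs G \<Longrightarrow> (y, m a) \<in> parcs G \<Longrightarrow> (x, y) \<in> parcs G"
  shows "very_well_covered G"
proof -
  interpret pair_graph G by fact
  have m_vert: "m v \<in> pverts G" if "v \<in> pverts G" for v
    using arc[OF that] in_arcsD2 by blast
  have half: "card (pverts G) = 2 * card I" if max: "maximal_independent_set G I" for I
  proof -
    have sub: "I \<subseteq> pverts G" and indep: "\<And>u v. u \<in> I \<Longrightarrow> v \<in> I \<Longrightarrow> (u, v) \<notin> parcs G"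
      using max by (auto simp: maximal_independent_set_def independent_set_def)
    have mate_in: "m a \<in> I" if a: "a \<in> pverts G" "a \<notin> I" for a
    proof (rule ccontr)
      assume "m a \<notin> I"
      with a obtain x y where "x \<in> I" "(x, a) \<in> parcs G" "y \<in> I" "(y, m a) \<in> parcs G"
        by (meson graph max m_vert maximal_independent_set_dominating)
      then show False
        using cross indep by blast
    qed
    have "pverts G = I \<union> m ` I"
    proof (intro equalityI subsetI)
      fix v
      assume v: "v \<in> pverts G"
      show "v \<in> I \<union> m ` I"
      proof (cases "v \<in> I")
        case False
        then have "m v \<in> I"
          using mate_in v by simp
        then have "m (m v) \<in> m ` I"
          by (rule imageI)
        then show ?thesis
          using invol[OF v] by simp
      qed simp
    next
      fix v
      assume "v \<in> I \<union> m ` I"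
      then show "v \<in> pverts G"
        using sub m_vert by auto
    qed
    moreover have "I \<inter> m ` I = {}"
      using sub arc indep by blast
    moreover have "inj_on m I"
      using sub invol by (metis inj_onI subsetD)
    moreover have "finite I"
      using sub pair_finite_verts finite_subset by blast
    ultimately show ?thesis
      by (simp add: card_Un_disjoint card_image)
  qed
  have "well_covered G"
    unfolding well_covered_def
  proof (intro conjI allI impI graph)
    fix I J
    assume "maximal_independent_set G I \<and> maximal_independent_set G J"
    then show "card I = card J"
      using half[of I] half[of J] by simp
  qed
  then show ?thesis
    unfolding very_well_covered_def isolated_vertex_def using half arc by blast
qed

lemma is_complement_sym:
  "a \<in> carrier L \<Longrightarrow> is_complement L a b \<Longrightarrow> is_complement L b a"
  by (simp add: is_complement_def insert_commute)

context boolean_poset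
begin

lemma Lower_pair_eq_bottom_iff:
  assumes "a \<in> carrier L" "b \<in> carrier L"
  shows "Lower L {a, b} = {\<bottom>} \<longleftrightarrow> (\<forall>z\<in>carrier L. z \<sqsubseteq> a \<longrightarrow> z \<sqsubseteq> b \<longrightarrow> z = \<bottom>)"
  using assms bottom_closed bottom_lower by (auto simp: Lower_def)

text \<open>The cone of \<open>{a, a'}\<close> above is \<open>{1}\<close>, so the left-hand side of the distributive law for
  \<open>x, a, a'\<close> is the set of all elements below \<open>x\<close>. On the right-hand side \<open>a'\<close> is an upper bound
  of both lower cones.\<close>

lemma disjoint_le_complement:
  assumes a: "a \<in> carrier L" and x: "x \<in> carrier L" and compl: "is_complement L a a'"
    and disj: "Lower L {x, a} = {\<bottom>}"
  shows "x \<sqsubseteq> a'"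
proof -
  have a': "a' \<in> carrier L" and top: "Upper L {a, a'} = {\<top>}"
    using compl by (auto simp: is_complement_def)
  have "x \<in> Lower L ({x} \<union> Upper L {a, a'})"
    unfolding top using x top_higher by (auto simp: Lower_def)
  also have "\<dots> = Lower L (Upper L (Lower L {x, a} \<union> Lower L {x, a'}))"
    using distributive[OF x a a'] .
  finally have "x \<in> Lower L (Upper L ({\<bottom>} \<union> Lower L {x, a'}))"
    by (simp add: disj)
  moreover have "a' \<in> Upper L ({\<bottom>} \<union> Lower L {x, a'})"
    using a' bottom_lower by (auto simp: Upper_def Lower_def)
  ultimately show ?thesis
    using a' unfolding Lower_def by blast
qed

lemma complement_unique:
  assumes a: "a \<in> carrier L" and b: "is_complement L a b" and c: "is_complement L a c"
  shows "b = c"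
proof -
  have carrier: "b \<in> carrier L" "c \<in> carrier L"
    and disj: "Lower L {b, a} = {\<bottom>}" "Lower L {c, a} = {\<bottom>}"
    using b c by (auto simp: is_complement_def insert_commute)
  have "b \<sqsubseteq> c" "c \<sqsubseteq> b"
    using disjoint_le_complement a b c carrier disj by blast+
  then show ?thesis
    using carrier le_antisym by blast
qed

definition compl :: "'a \<Rightarrow> 'a" where
  "compl a = (THE b. is_complement L a b)"

lemma compl_eqI:
  assumes "a \<in> carrier L" and "is_complement L a b"
  shows "compl a = b"
  unfolding compl_def using assms complement_unique by blast

lemma is_complement_compl:
  assumes "a \<in> carrier L"
  shows "is_complement L a (compl a)"
  using complemented[OF assms] compl_eqI[OF assms] by metis

lemma compl_closed: "a \<in> carrier L \<Longrightarrow> compl a \<in> carrier L"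
  using is_complement_compl by (simp add: is_complement_def)

lemma Lower_compl: "a \<in> carrier L \<Longrightarrow> Lower L {a, compl a} = {\<bottom>}"
  using is_complement_compl by (simp add: is_complement_def)

lemma compl_compl: "a \<in> carrier L \<Longrightarrow> compl (compl a) = a"
  by (simp add: compl_closed compl_eqI is_complement_compl is_complement_sym)

text \<open>This is the condition on neighbours of matched vertices: \<open>x\<close> lies below the complement of
  \<open>a\<close>, and whatever is disjoint from the latter is disjoint from \<open>x\<close>.\<close>

lemma disjoint_if_disjoint_compl:
  assumes carrier: "x \<in> carrier L" "a \<in> carrier L" "y \<in> carrier L"
    and xa: "Lower L {x, a} = {\<bottom>}" and ya: "Lower L {y, compl a} = {\<bottom>}"
  shows "Lower L {x, y} = {\<bottom>}"
proof -
  have "x \<sqsubseteq> compl a"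
    using disjoint_le_complement is_complement_compl carrier xa by blast
  then have "z \<sqsubseteq> compl a" if "z \<in> carrier L" "z \<sqsubseteq> x" for z
    using that carrier compl_closed le_trans by blast
  then show ?thesis
    using ya carrier compl_closed by (simp add: Lower_pair_eq_bottom_iff)
qed

lemma parcs_zero_divisor_graph_iff:
  "(a, b) \<in> parcs (zero_divisor_graph L) \<longleftrightarrow>
     a \<in> carrier L - {\<bottom>} \<and> b \<in> carrier L - {\<bottom>} \<and> Lower L {a, b} = {\<bottom>}"
proof -
  have "a = \<bottom>" if "a \<in> carrier L" "Lower L {a, a} = {\<bottom>}"
    using that Lower_pair_eq_bottom_iff[of a a] le_refl by blast
  moreover have "Lower L {a, b} = Lower L {b, a}"
    by (simp add: insert_commute)
  ultimately show ?thesis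
    by (auto simp: zero_divisor_graph_def zero_divisors_def)
qed

lemma pverts_zero_divisor_graph:
  "v \<in> pverts (zero_divisor_graph L) \<longleftrightarrow> (\<exists>b. (v, b) \<in> parcs (zero_divisor_graph L))"
  unfolding parcs_zero_divisor_graph_iff
  by (auto simp: zero_divisor_graph_def zero_divisors_def)

text \<open>A vertex \<open>v\<close> has a nonzero \<open>b\<close> disjoint from it, and \<open>b\<close> lies below the complement of
  \<open>v\<close>, which is therefore nonzero as well.\<close>

lemma compl_adjacent:
  assumes "v \<in> pverts (zero_divisor_graph L)"
  shows "(v, compl v) \<in> parcs (zero_divisor_graph L)"
proof -
  obtain b where v: "v \<in> carrier L" "v \<noteq> \<bottom>" and b: "b \<in> carrier L" "b \<noteq> \<bottom>"
    and disj: "Lower L {v, b} = {\<bottom>}"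
    using assms by (auto simp: pverts_zero_divisor_graph parcs_zero_divisor_graph_iff)
  have "b \<sqsubseteq> compl v"
    using disjoint_le_complement[OF v(1) b(1) is_complement_compl[OF v(1)]] disj
    by (simp add: insert_commute)
  then have "compl v \<noteq> \<bottom>"
    using b bottom_closed bottom_lower le_antisym by metis
  then show ?thesis
    using v compl_closed Lower_compl by (simp add: parcs_zero_divisor_graph_iff)
qed

lemma pair_graph_zero_divisor_graph:
  assumes "finite (carrier L)"
  shows "pair_graph (zero_divisor_graph L)"
proof
  let ?G = "zero_divisor_graph L"
  show fin: "finite (pverts ?G)"
    using assms by (rule finite_subset[rotated])
      (auto simp: zero_divisor_graph_def zero_divisors_def)
  have "parcs ?G \<subseteq> pverts ?G \<times> pverts ?G"
    by (auto simp: zero_divisor_graph_def Let_def)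
  then show "finite (parcs ?G)"
    using fin finite_subset by blast
  show "fst e \<in> pverts ?G" "snd e \<in> pverts ?G" "fst e \<noteq> snd e" if "e \<in> parcs ?G" for e
    using that by (auto simp: zero_divisor_graph_def Let_def)
  show "symmetric ?G"
    by (auto simp: symmetric_def parcs_zero_divisor_graph_iff insert_commute intro!: symI)
qed

lemma very_well_covered_zero_divisor_graph:
  assumes "finite (carrier L)"
  shows "very_well_covered (zero_divisor_graph L)"
proof (rule very_well_covered_if_matching)
  let ?G = "zero_divisor_graph L"
  show "pair_graph ?G"
    using assms by (rule pair_graph_zero_divisor_graph)
  show "(v, compl v) \<in> parcs ?G" if "v \<in> pverts ?G" for v
    using that by (rule compl_adjacent)
  show "compl (compl v) = v" if "v \<in> pverts ?G" for v
    using compl_adjacent[OF that] compl_compl by (simp add: parcs_zero_divisor_graph_iff)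
  show "(x, y) \<in> parcs ?G" if "(x, a) \<in> parcs ?G" "(y, compl a) \<in> parcs ?G" for x a y
    using that disjoint_if_disjoint_compl[of x a y] by (simp add: parcs_zero_divisor_graph_iff)
qed

end

theorem theorem3p1:
  fixes P :: "('a, 'b) gorder_scheme"
  assumes "boolean_poset P"
    and "finite (carrier P)"
    and "card {a. is_atom P a} \<ge> 2"
  shows "very_well_covered (zero_divisor_graph P)"
  using assms by (intro boolean_poset.very_well_covered_zero_divisor_graph)

end
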